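(* Let $\bm{c}_1,\dots,\bm{c}_N\in\mathbb{R}^4$ be correspondences with $\bm{c}_i=(x_i,y_i,u_i,v_i)$, let $\bm{m}\in\mathbb{R}^{N\times 2}$ be the matrix whose $i$-th row is the motion $\bm{m}_i=(u_i-x_i,\,v_i-y_i)$, let $\bm{L}\in\mathbb{R}^{N\times N}$ be the Laplacian matrix of the weighted $k$-nearest-neighbor graph on $\{\bm{c}_i\}$ (as defined in the context), and let $\eta>0$ be a predefined constant. Let the eigenvalue decomposition of $\bm{L}$ be $\bm{L}=\bm{U}\bm{\Lambda}\bm{U}^{\top}$, where $\bm{\Lambda}=\mathrm{diag}(\lambda_1,\dots,\lambda_N)$ is the diagonal matrix of eigenvalues $\lambda_i$ and the columns of the orthogonal matrix $\bm{U}\in\mathbb{R}^{N\times N}$ are the associated eigenvectors. Then the solution to the problem $$\mathop{\mathrm{minimize}}_{\bm{s}\in\mathbb{R}^{N\times 2}}\ \operatorname{Tr}\big((\bm{s}-\bm{m})^{\top}(\bm{s}-\bm{m})\big)+\eta\,\operatorname{Tr}\big(\bm{s}^{\top}\bm{L}\bm{s}\big)$$ is $$\bm{s}=\bm{U}\,\mathrm{diag}\!\left(\frac{1}{1+\eta\lambda_1},\dots,\frac{1}{1+\eta\lambda_N}\right)\bm{U}^{\top}\bm{m}.$$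
   Context: The graph $G=\{V,E\}$ is built as follows. The nodes in $V$ represent the correspondences $\bm{c}_1,\dots,\bm{c}_N$, and $E$ includes the edges from every correspondence to its $k$ nearest neighbors according to the coordinate distance $d_{i,j}=\|\bm{c}_i-\bm{c}_j\|_2$. The weights associated with the edges are $w_{i,j}=\exp(-d_{i,j}^2/\sigma^2)$, where $\sigma$ is a predefined constant; $w_{i,j}=0$ when there is no edge, and $w_{i,i}=0$ for all nodes. The adjacency matrix is $\bm{A}=[w_{i,j}]$, the degree matrix is $\bm{D}=\mathrm{diag}(d_1,\dots,d_N)$ with $d_i=\sum_j w_{i,j}$, and the Laplacian matrix is $\bm{L}=\bm{D}-\bm{A}$. Here $\mathrm{diag}(\cdot)$ denotes the diagonal matrix with the given diagonal entries and $\operatorname{Tr}$ the trace. *)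

theory Defs
  imports "HOL-Analysis.Analysis"
begin

definition diag_mat :: "real ^ 'n \<Rightarrow> real ^ 'n ^ 'n" where
  "diag_mat d = (\<chi> i j. if i = j then d $ i else 0)"

text \<open>A correspondence \<open>(x, y, u, v)\<close> is a vector with components \<open>1, 2, 3, 4\<close>.\<close>

definition motion_matrix :: "('n \<Rightarrow> real ^ 4) \<Rightarrow> real ^ 2 ^ 'n" where
  "motion_matrix c = (\<chi> i. vector [c i $ 3 - c i $ 1, c i $ 4 - c i $ 2])"

text \<open>Because of ties in the distances, the \<open>k\<close> nearest neighbours of a node need not be
  unique: \<open>nn\<close> is any function that selects, for every node \<open>i\<close>, exactly \<open>k\<close> other nodes such
  that no unselected node is strictly closer to \<open>c i\<close> than a selected one.\<close>

definition nearest_neighbours :: "nat \<Rightarrow> ('n::finite \<Rightarrow> real ^ 4) \<Rightarrow> ('n \<Rightarrow> 'n set) \<Rightarrow> bool" where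
  "nearest_neighbours k c nn \<longleftrightarrow>
     (\<forall>i. i \<notin> nn i \<and> card (nn i) = k \<and>
          (\<forall>j \<in> nn i. \<forall>l. l \<notin> nn i \<longrightarrow> l \<noteq> i \<longrightarrow> norm (c i - c j) \<le> norm (c i - c l)))"

text \<open>The graph is undirected: \<open>i\<close> and \<open>j\<close> are adjacent if at least one of them is selected
  as a neighbour of the other.\<close>

definition knn_edges :: "('n \<Rightarrow> 'n set) \<Rightarrow> ('n \<times> 'n) set" where
  "knn_edges nn = {(i, j). i \<noteq> j \<and> (j \<in> nn i \<or> i \<in> nn j)}"

definition adjacency_matrix ::
    "real \<Rightarrow> ('n::finite \<Rightarrow> real ^ 4) \<Rightarrow> ('n \<times> 'n) set \<Rightarrow> real ^ 'n ^ 'n" where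
  "adjacency_matrix \<sigma> c E =
     (\<chi> i j. if (i, j) \<in> E then exp (- (norm (c i - c j))\<^sup>2 / \<sigma>\<^sup>2) else 0)"

definition degree_matrix :: "real ^ 'n ^ 'n \<Rightarrow> real ^ 'n ^ 'n" where
  "degree_matrix A = diag_mat (\<chi> i. \<Sum>j\<in>UNIV. A $ i $ j)"

definition laplacian :: "real ^ 'n ^ 'n \<Rightarrow> real ^ 'n ^ 'n" where
  "laplacian A = degree_matrix A - A"

definition objective ::
    "real \<Rightarrow> real ^ 'n ^ 'n \<Rightarrow> real ^ 2 ^ 'n \<Rightarrow> real ^ 2 ^ 'n \<Rightarrow> real" where
  "objective \<eta> L m s =
     trace (transpose (s - m) ** (s - m)) + \<eta> * trace (transpose s ** L ** s)"

end

(*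
  In the coordinates t = U^T s, p = U^T m the objective separates into the scalar quadratics
  (t_ia - p_ia)^2 + eta lambda_i t_ia^2. The Laplacian is positive semidefinite, since
  2 x^T L x is the sum of the w_ij (x_i - x_j)^2, so 1 + eta lambda_i > 0 and completing the
  square shows that t_ia = p_ia / (1 + eta lambda_i) is the unique minimiser of each of them.
*)
theory Submission
  imports Defs
begin

lemma diag_mat_mult_nth:
  fixes A :: "real ^ 'm ^ 'n"
  shows "(diag_mat d ** A) $ i $ a = d $ i * A $ i $ a"
  by (simp add: diag_mat_def matrix_matrix_mult_def if_distrib[where f = "\<lambda>x. x * _"] cong: if_cong)

lemma diag_mat_mult_vec_nth: "(diag_mat d *v x) $ i = d $ i * x $ i"
  by (simp add: diag_mat_def matrix_vector_mult_def if_distrib[where f = "\<lambda>x. x * _"] cong: if_cong)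

text \<open>The Frobenius inner product; it turns both traces of the objective into sums over
  entries.\<close>

lemma trace_transpose_mult:
  fixes A B :: "real ^ 'm ^ 'n"
  shows "trace (transpose A ** B) = (\<Sum>i\<in>UNIV. \<Sum>a\<in>UNIV. A $ i $ a * B $ i $ a)"
  unfolding trace_def transpose_def matrix_matrix_mult_def
  by (simp, rule sum.swap)

text \<open>Expanding the square gives two square terms. By symmetry of \<open>A\<close> each equals
  the degree term, hence the factor 2; the cross term comes from \<open>A\<close> itself.\<close>

lemma laplacian_quadratic_form:
  fixes A :: "real ^ 'n ^ 'n"
  assumes sym: "\<And>i j. A $ i $ j = A $ j $ i"
  shows "2 * (x \<bullet> (laplacian A *v x)) = (\<Sum>i\<in>UNIV. \<Sum>j\<in>UNIV. A $ i $ j * (x $ i - x $ j)\<^sup>2)"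
proof -
  let ?S = "\<Sum>i\<in>UNIV. \<Sum>j\<in>UNIV. A $ i $ j * (x $ i)\<^sup>2"
  let ?T = "\<Sum>i\<in>UNIV. \<Sum>j\<in>UNIV. A $ i $ j * (x $ j)\<^sup>2"
  let ?X = "\<Sum>i\<in>UNIV. \<Sum>j\<in>UNIV. A $ i $ j * (x $ i * x $ j)"
  have "(laplacian A *v x) $ i = (\<Sum>j\<in>UNIV. A $ i $ j * x $ i) - (\<Sum>j\<in>UNIV. A $ i $ j * x $ j)" for i
    by (simp add: laplacian_def degree_matrix_def matrix_vector_mult_diff_rdistrib
        diag_mat_mult_vec_nth sum_distrib_right)
      (simp add: matrix_vector_mult_def)
  then have "x \<bullet> (laplacian A *v x) = ?S - ?X"
    by (simp add: inner_vec_def right_diff_distrib sum_subtractf sum_distrib_left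
        power2_eq_square mult_ac)
  moreover have "?T = ?S"
    by (subst sum.swap) (simp add: sym)
  moreover have "(\<Sum>i\<in>UNIV. \<Sum>j\<in>UNIV. A $ i $ j * (x $ i - x $ j)\<^sup>2) = ?S + ?T - 2 * ?X"
    by (simp add: power2_diff algebra_simps sum.distrib sum_subtractf sum_distrib_left)
  ultimately show ?thesis by simp
qed

lemma laplacian_psd:
  fixes A :: "real ^ 'n ^ 'n"
  assumes "\<And>i j. A $ i $ j = A $ j $ i" and "\<And>i j. 0 \<le> A $ i $ j"
  shows "0 \<le> x \<bullet> (laplacian A *v x)"
proof -
  have "0 \<le> 2 * (x \<bullet> (laplacian A *v x))"
    unfolding laplacian_quadratic_form[OF assms(1)] by (intro sum_nonneg mult_nonneg_nonneg assms(2)) simp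
  then show ?thesis by simp
qed

text \<open>Being selected as a neighbour is not a symmetric relation; \<open>knn_edges\<close>
  symmetrises it, and the weight depends only on the distance.\<close>

lemma adjacency_matrix_sym:
  "adjacency_matrix \<sigma> c (knn_edges nn) $ i $ j = adjacency_matrix \<sigma> c (knn_edges nn) $ j $ i"
  by (auto simp: adjacency_matrix_def knn_edges_def norm_minus_commute)

lemma adjacency_matrix_nonneg: "0 \<le> adjacency_matrix \<sigma> c E $ i $ j"
  by (simp add: adjacency_matrix_def)

text \<open>Evaluate the form at the \<open>i\<close>-th column of \<open>U\<close>, a unit
  eigenvector, where its value is the eigenvalue.\<close>

lemma orthogonal_eigenvalue_nonneg:
  fixes U :: "real ^ 'n ^ 'n"
  assumes orth: "orthogonal_matrix U"
    and psd: "\<And>x. 0 \<le> x \<bullet> ((U ** diag_mat lam ** transpose U) *v x)"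
  shows "0 \<le> lam $ i"
proof -
  let ?e = "axis i 1 :: real ^ 'n"
  have "transpose U *v (U *v ?e) = ?e"
    using orth by (simp add: matrix_vector_mul_assoc orthogonal_matrix)
  \<comment> \<open>The outer \<open>U\<close> crosses the inner product as
    \<open>transpose U\<close>, so \<open>U *v ?e\<close> collapses to \<open>?e\<close> on both
    sides.\<close>
  then have "(U *v ?e) \<bullet> ((U ** diag_mat lam ** transpose U) *v (U *v ?e)) = ?e \<bullet> (diag_mat lam *v ?e)"
    by (metis dot_lmul_matrix matrix_vector_mul_assoc transpose_matrix_vector)
  also have "\<dots> = lam $ i"
    by (simp add: inner_axis' diag_mat_mult_vec_nth)
  finally show ?thesis using psd by metis
qed

text \<open>The fidelity term is invariant under the isometry \<open>transpose U\<close>; in the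
  smoothness term the outer factors of the Laplacian are absorbed into \<open>s\<close>.\<close>

lemma objective_orthogonal:
  assumes "orthogonal_matrix U"
  shows "objective \<eta> (U ** D ** transpose U) m s = objective \<eta> D (transpose U ** m) (transpose U ** s)"
proof -
  have "transpose U ** s - transpose U ** m = transpose U ** (s - m)"
    by (simp add: matrix_matrix_mult_def vec_eq_iff right_diff_distrib sum_subtractf)
  then have "transpose (transpose U ** s - transpose U ** m) ** (transpose U ** s - transpose U ** m)
      = transpose (s - m) ** (U ** transpose U) ** (s - m)"
    by (simp add: matrix_transpose_mul matrix_mul_assoc)
  also have "\<dots> = transpose (s - m) ** (s - m)"
    using assms by (simp add: orthogonal_matrix_def)
  finally show ?thesis
    unfolding objective_def by (simp add: matrix_transpose_mul matrix_mul_assoc)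
qed

lemma objective_diag_mat:
  "objective \<eta> (diag_mat lam) p t =
    (\<Sum>i\<in>UNIV. \<Sum>a\<in>UNIV. (t $ i $ a - p $ i $ a)\<^sup>2 + \<eta> * lam $ i * (t $ i $ a)\<^sup>2)"
  \<comment> \<open>Associating to the right exposes the form
    \<open>transpose t ** (diag_mat lam ** t)\<close>.\<close>
  unfolding objective_def matrix_mul_assoc[symmetric] trace_transpose_mult
  by (simp add: diag_mat_mult_nth sum_distrib_left sum.distrib power2_eq_square mult_ac)

lemma objective_diag_mat_complete_square:
  assumes pos: "\<And>i. 0 < 1 + \<eta> * lam $ i"
    and t0: "t0 = diag_mat (\<chi> i. 1 / (1 + \<eta> * lam $ i)) ** p"
  shows "objective \<eta> (diag_mat lam) p t = objective \<eta> (diag_mat lam) p t0 +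
    (\<Sum>i\<in>UNIV. \<Sum>a\<in>UNIV. (1 + \<eta> * lam $ i) * (t $ i $ a - t0 $ i $ a)\<^sup>2)"
proof -
  have "(t $ i $ a - p $ i $ a)\<^sup>2 + \<eta> * lam $ i * (t $ i $ a)\<^sup>2 =
      (t0 $ i $ a - p $ i $ a)\<^sup>2 + \<eta> * lam $ i * (t0 $ i $ a)\<^sup>2 +
      (1 + \<eta> * lam $ i) * (t $ i $ a - t0 $ i $ a)\<^sup>2" for i a
  proof -
    \<comment> \<open>This is the stationarity condition of the scalar quadratic. Substituting it
      for \<open>p\<close> leaves a polynomial identity without division.\<close>
    have "p $ i $ a = (1 + \<eta> * lam $ i) * t0 $ i $ a"
      using pos[of i] by (simp add: t0 diag_mat_mult_nth)
    then show ?thesis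
      by (simp only:) (simp add: power2_eq_square algebra_simps)
  qed
  then show ?thesis
    by (simp add: objective_diag_mat sum.distrib)
qed

text \<open>Up to a constant the objective is the weighted squared distance \<open>Q\<close> to
  \<open>t0\<close>; strictly positive weights make \<open>t0\<close> its only zero, which gives
  uniqueness.\<close>

lemma is_arg_min_objective_diag_mat:
  assumes pos: "\<And>i. 0 < 1 + \<eta> * lam $ i"
  shows "is_arg_min (objective \<eta> (diag_mat lam) p) (\<lambda>_. True) t \<longleftrightarrow>
    t = diag_mat (\<chi> i. 1 / (1 + \<eta> * lam $ i)) ** p"
proof -
  define t0 where "t0 = diag_mat (\<chi> i. 1 / (1 + \<eta> * lam $ i)) ** p"
  define Q where "Q t = (\<Sum>i\<in>UNIV. \<Sum>a\<in>UNIV. (1 + \<eta> * lam $ i) * (t $ i $ a - t0 $ i $ a)\<^sup>2)"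
    for t :: "real ^ 2 ^ 'a"
  have obj: "objective \<eta> (diag_mat lam) p t = objective \<eta> (diag_mat lam) p t0 + Q t" for t
    unfolding Q_def by (rule objective_diag_mat_complete_square[OF pos t0_def])
  have nonneg: "0 \<le> Q t" for t
    unfolding Q_def by (intro sum_nonneg mult_nonneg_nonneg less_imp_le[OF pos]) simp
  have zero: "Q t = 0 \<longleftrightarrow> t = t0" for t
    unfolding Q_def
    using less_imp_le[OF pos] pos[THEN less_imp_neq]
    by (simp add: sum_nonneg_eq_0_iff sum_nonneg vec_eq_iff)
  have "is_arg_min (objective \<eta> (diag_mat lam) p) (\<lambda>_. True) t \<longleftrightarrow> (\<forall>u. Q t \<le> Q u)"
    unfolding is_arg_min_linorder using obj by (metis add_le_cancel_left)
  \<comment> \<open>The minimum of \<open>Q\<close> is 0, attained at \<open>t0\<close>.\<close>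
  also have "\<dots> \<longleftrightarrow> Q t = 0"
    using nonneg zero by (metis order_antisym)
  finally show ?thesis by (simp add: zero t0_def)
qed

theorem proposition1:
  fixes c :: "'n::finite \<Rightarrow> real ^ 4"
    and k :: nat
    and nn :: "'n \<Rightarrow> 'n set"
    and \<sigma> \<eta> :: real
    and m :: "real ^ 2 ^ 'n"
    and L U :: "real ^ 'n ^ 'n"
    and lam :: "real ^ 'n"
  assumes "m = motion_matrix c"
    and "nearest_neighbours k c nn"
    and "\<sigma> \<noteq> 0"
    and "L = laplacian (adjacency_matrix \<sigma> c (knn_edges nn))"
    and "\<eta> > 0"
    and "orthogonal_matrix U"
    and "L = U ** diag_mat lam ** transpose U"
  shows "\<forall>s. is_arg_min (objective \<eta> L m) (\<lambda>_. True) s \<longleftrightarrow>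
    s = U ** diag_mat (\<chi> i. 1 / (1 + \<eta> * lam $ i)) ** transpose U ** m"
proof
  fix s
  let ?F = "diag_mat (\<chi> i. 1 / (1 + \<eta> * lam $ i))"
  have U: "U ** transpose U = mat 1" "transpose U ** U = mat 1"
    using \<open>orthogonal_matrix U\<close> by (auto simp: orthogonal_matrix_def)
  have "0 \<le> x \<bullet> (L *v x)" for x
    unfolding \<open>L = laplacian _\<close>
    by (intro laplacian_psd adjacency_matrix_sym adjacency_matrix_nonneg)
  then have "0 \<le> lam $ i" for i
    using orthogonal_eigenvalue_nonneg \<open>orthogonal_matrix U\<close> \<open>L = U ** _ ** _\<close> by blast
  then have pos: "0 < 1 + \<eta> * lam $ i" for i
    using \<open>\<eta> > 0\<close> by (simp add: add_pos_nonneg)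
  have obj: "objective \<eta> L m u = objective \<eta> (diag_mat lam) (transpose U ** m) (transpose U ** u)" for u
    unfolding \<open>L = U ** _ ** _\<close> by (rule objective_orthogonal[OF \<open>orthogonal_matrix U\<close>])
  have cancel: "transpose U ** (U ** t) = t" for t :: "real ^ 2 ^ 'n"
    by (simp add: matrix_mul_assoc U)
  have "is_arg_min (objective \<eta> L m) (\<lambda>_. True) s \<longleftrightarrow>
      is_arg_min (objective \<eta> (diag_mat lam) (transpose U ** m)) (\<lambda>_. True) (transpose U ** s)"
    \<comment> \<open>By \<open>cancel\<close> every \<open>t\<close> has the form
      \<open>transpose U ** u\<close>, so minimality over all \<open>u\<close> is minimality over
      all \<open>t\<close>.\<close>
    unfolding is_arg_min_linorder obj using cancel by metis
  also have "\<dots> \<longleftrightarrow> transpose U ** s = ?F ** (transpose U ** m)"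
    by (rule is_arg_min_objective_diag_mat[OF pos])
  also have "\<dots> \<longleftrightarrow> U ** (transpose U ** s) = U ** (?F ** (transpose U ** m))"
    using cancel by metis
  also have "\<dots> \<longleftrightarrow> s = U ** ?F ** transpose U ** m"
    by (simp add: matrix_mul_assoc U)
  finally show "is_arg_min (objective \<eta> L m) (\<lambda>_. True) s \<longleftrightarrow> s = U ** ?F ** transpose U ** m" .
qed

end
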